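(* For every integer $k\geq 2$, $$N(k)\leq\frac{1}{2}\binom{2k-2}{k-1}+n(k,k-2).$$
   Context: A family is a family of finite sets; its members are blocks, the elements of blocks are its points, and its point set is the union of its blocks. A blocking set of a family $\mathcal{F}$ is a set meeting every block; if a finite blocking set exists, a transversal is a blocking set of minimum size and $\mathcal{F}^{\top}$ is the family of all transversals. A family $\mathcal{F}$ is a maximal intersecting family of $k$-sets, an $MIF(k)$, if it has a finite blocking set, $\mathcal{F}=\mathcal{F}^{\top}$, and all its blocks have size $k$ (equivalently: a family of pairwise intersecting $k$-sets such that no $k$-set outside the family meets all its blocks). $N(k)$ denotes the maximum number of points of an $MIF(k)$. An intersecting set pair system with parameter $(k,t)$, an $ISP(k,t)$, is a collection $\{(A_i,B_i):1\le i\le n\}$ of pairs of finite sets with $\#A_i=k$, $\#B_i=t$ for all $i$, such that $A_i\cap B_j=\emptyset$ if and only if $i=j$; its point set is $\bigcup_i (A_i\cup B_i)$. $n(k,t)$ denotes the maximum number of points of an $ISP(k,t)$. (For $k=2$, $n(2,0)$ is understood with $t=0$, i.e. each $B_i=\emptyset$.) *)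

theory Defs
  imports Complex_Main
begin

definition points :: "'a set set \<Rightarrow> 'a set" where
  "points F = \<Union>F"

definition blocking_set :: "'a set set \<Rightarrow> 'a set \<Rightarrow> bool" where
  "blocking_set F X \<longleftrightarrow> (\<forall>B\<in>F. X \<inter> B \<noteq> {})"

definition transversal :: "'a set set \<Rightarrow> 'a set \<Rightarrow> bool" where
  "transversal F X \<longleftrightarrow> finite X \<and> blocking_set F X \<and>
     (\<forall>Y. finite Y \<and> blocking_set F Y \<longrightarrow> card X \<le> card Y)"

definition transversals :: "'a set set \<Rightarrow> 'a set set" where
  "transversals F = {X. transversal F X}"

definition MIF :: "nat \<Rightarrow> 'a set set \<Rightarrow> bool" where
  "MIF k F \<longleftrightarrow> (\<exists>X. finite X \<and> blocking_set F X) \<and> F = transversals F \<and>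
     (\<forall>B\<in>F. finite B \<and> card B = k)"

definition ISP :: "nat \<Rightarrow> nat \<Rightarrow> nat \<Rightarrow> (nat \<Rightarrow> 'a set) \<Rightarrow> (nat \<Rightarrow> 'a set) \<Rightarrow> bool" where
  "ISP k t n A B \<longleftrightarrow>
     (\<forall>i\<in>{1..n}. finite (A i) \<and> finite (B i) \<and> card (A i) = k \<and> card (B i) = t) \<and>
     (\<forall>i\<in>{1..n}. \<forall>j\<in>{1..n}. A i \<inter> B j = {} \<longleftrightarrow> i = j)"

definition ISP_points :: "nat \<Rightarrow> (nat \<Rightarrow> 'a set) \<Rightarrow> (nat \<Rightarrow> 'a set) \<Rightarrow> 'a set" where
  "ISP_points n A B = (\<Union>i\<in>{1..n}. A i \<union> B i)"

text \<open>
  Points of the competing structures are taken to be natural numbers. The lemmas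
  \<open>MIF_card_points_le_N\<close> and \<open>ISP_card_points_le_nn\<close> below show that this loses nothing:
  over any type of points, the point set is finite and has at most as many elements.
  The lemmas \<open>N_set_finite\<close>, \<open>N_set_nonempty\<close>, \<open>nn_set_finite\<close> and \<open>nn_set_nonempty\<close> show
  that the maxima exist (for \<open>N\<close>, when \<open>k\<close> is positive).
\<close>

definition N :: "nat \<Rightarrow> nat" where
  "N k = Max {card (points F) | F :: nat set set. MIF k F}"

definition nn :: "nat \<Rightarrow> nat \<Rightarrow> nat" where
  "nn k t = Max {card (ISP_points n A B) | n (A :: nat \<Rightarrow> nat set) (B :: nat \<Rightarrow> nat set). ISP k t n A B}"


lemma MIF_I:
  assumes "F \<noteq> {}" "\<And>B. B \<in> F \<Longrightarrow> finite B \<and> card B = k"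
    and "\<And>B C. B \<in> F \<Longrightarrow> C \<in> F \<Longrightarrow> B \<inter> C \<noteq> {}"
    and min: "\<And>Y. finite Y \<Longrightarrow> blocking_set F Y \<Longrightarrow> k \<le> card Y"
    and max: "\<And>Y. finite Y \<Longrightarrow> blocking_set F Y \<Longrightarrow> card Y = k \<Longrightarrow> Y \<in> F"
  shows "MIF k F"
proof -
  have bl: "blocking_set F B" if "B \<in> F" for B
    using assms(3) that by (auto simp: blocking_set_def)
  obtain B where B: "B \<in> F" using assms(1) by blast
  have "F = transversals F"
  proof
    show "F \<subseteq> transversals F"
      using bl assms(2) min by (auto simp: transversals_def transversal_def)
    show "transversals F \<subseteq> F"
    proof
      fix X assume "X \<in> transversals F"
      then have X: "finite X" "blocking_set F X" "card X \<le> card B"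
        using bl[OF B] assms(2)[OF B] by (auto simp: transversals_def transversal_def)
      then have "card X = k" using min[OF X(1,2)] assms(2)[OF B] by simp
      then show "X \<in> F" using max X by blast
    qed
  qed
  then show ?thesis
    unfolding MIF_def using B bl assms(2) by blast
qed

lemma MIF_D:
  assumes "MIF k F"
  shows "F \<noteq> {}" "\<And>B. B \<in> F \<Longrightarrow> finite B \<and> card B = k"
    and "\<And>B C. B \<in> F \<Longrightarrow> C \<in> F \<Longrightarrow> B \<inter> C \<noteq> {}"
    and "\<And>Y. finite Y \<Longrightarrow> blocking_set F Y \<Longrightarrow> k \<le> card Y"
    and "\<And>Y. finite Y \<Longrightarrow> blocking_set F Y \<Longrightarrow> card Y = k \<Longrightarrow> Y \<in> F"
proof -
  have eq: "F = transversals F" and size: "\<And>B. B \<in> F \<Longrightarrow> finite B \<and> card B = k"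
    using assms by (auto simp: MIF_def)
  have "{} \<in> transversals F" if "F = {}"
    using that by (simp add: transversals_def transversal_def blocking_set_def)
  then show ne: "F \<noteq> {}" using eq by blast
  then obtain B where "B \<in> F" by blast
  then have B: "transversal F B" "card B = k"
    using eq size by (auto simp: transversals_def)
  show "\<And>B. B \<in> F \<Longrightarrow> finite B \<and> card B = k" by (fact size)
  show "B \<inter> C \<noteq> {}" if "B \<in> F" "C \<in> F" for B C
  proof -
    have "transversal F B" using that eq by (auto simp: transversals_def)
    then show ?thesis using that by (auto simp: transversal_def blocking_set_def)
  qed
  show min: "k \<le> card Y" if "finite Y" "blocking_set F Y" for Y
    using that B by (auto simp: transversal_def)
  show "Y \<in> F" if "finite Y" "blocking_set F Y" "card Y = k" for Y
  proof -
    have "transversal F Y" using that min by (auto simp: transversal_def)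
    then show ?thesis using eq by (auto simp: transversals_def)
  qed
qed

lemma MIF_superset_bound:
  assumes F: "MIF k F"
  shows "finite S \<Longrightarrow> card S + d = k \<Longrightarrow>
    finite {X\<in>F. S \<subseteq> X} \<and> card {X\<in>F. S \<subseteq> X} \<le> k ^ d"
proof (induction d arbitrary: S)
  case 0
  have "{X\<in>F. S \<subseteq> X} \<subseteq> {S}"
  proof
    fix X assume "X \<in> {X\<in>F. S \<subseteq> X}"
    then have "S = X" using 0 MIF_D(2)[OF F, of X] by (intro card_subset_eq) auto
    then show "X \<in> {S}" by simp
  qed
  then show ?case
    using card_mono[of "{S}" "{X\<in>F. S \<subseteq> X}"] finite_subset by auto
next
  case (Suc d)
  have "\<not> blocking_set F S" using MIF_D(4)[OF F] Suc.prems by fastforce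
  then obtain B where B: "B \<in> F" "S \<inter> B = {}" by (auto simp: blocking_set_def)
  have fB: "finite B" "card B = k" using B MIF_D(2)[OF F] by auto
  have sub: "{X\<in>F. S \<subseteq> X} \<subseteq> (\<Union>x\<in>B. {X\<in>F. insert x S \<subseteq> X})"
  proof
    fix X assume "X \<in> {X\<in>F. S \<subseteq> X}"
    moreover from this obtain x where "x \<in> X" "x \<in> B" using MIF_D(3)[OF F _ B(1)] by blast
    ultimately show "X \<in> (\<Union>x\<in>B. {X\<in>F. insert x S \<subseteq> X})" by auto
  qed
  have IH: "finite {X\<in>F. insert x S \<subseteq> X} \<and> card {X\<in>F. insert x S \<subseteq> X} \<le> k ^ d"
    if "x \<in> B" for x
    using that B Suc.prems by (intro Suc.IH) (auto simp: card_insert_if)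
  have fin: "finite (\<Union>x\<in>B. {X\<in>F. insert x S \<subseteq> X})" using fB IH by blast
  have "card {X\<in>F. S \<subseteq> X} \<le> card (\<Union>x\<in>B. {X\<in>F. insert x S \<subseteq> X})"
    using sub fin by (rule card_mono[rotated])
  also have "\<dots> \<le> (\<Sum>x\<in>B. card {X\<in>F. insert x S \<subseteq> X})" by (rule card_UN_le[OF fB(1)])
  also have "\<dots> \<le> (\<Sum>x\<in>B. k ^ d)" using IH by (intro sum_mono) auto
  also have "\<dots> = k ^ Suc d" using fB by simp
  finally show ?case using sub fin finite_subset by blast
qed

lemma MIF_points_bound:
  assumes F: "MIF k F"
  shows "finite (points F)" "card (points F) \<le> k ^ k * k"
proof -
  have "finite F" "card F \<le> k ^ k" using MIF_superset_bound[OF F, of "{}" k] by auto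
  then show "finite (points F)" using MIF_D(2)[OF F] by (auto simp: points_def)
  have "card (points F) \<le> (\<Sum>B\<in>F. card B)"
    unfolding points_def using card_UN_le[OF \<open>finite F\<close>, of "\<lambda>x. x"] by simp
  also have "\<dots> = card F * k" using MIF_D(2)[OF F] by simp
  finally show "card (points F) \<le> k ^ k * k"
    using \<open>card F \<le> k ^ k\<close> by (meson mult_le_mono1 order_trans)
qed

lemma N_set_finite: "finite {card (points F) | F :: nat set set. MIF k F}"
  by (rule finite_subset[of _ "{..k ^ k * k}"]) (auto dest: MIF_points_bound(2))

lemma N_set_nonempty:
  assumes "k \<ge> 1"
  shows "{card (points F) | F :: nat set set. MIF k F} \<noteq> {}"
proof -
  define V where "V = {..<2 * k - 1}"
  define F where "F = {X. X \<subseteq> V \<and> card X = k}"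
  have V: "finite V" "card V = 2 * k - 1" by (auto simp: V_def)
  have big: "k \<le> card (Y \<inter> V)" if "blocking_set F Y" for Y
  proof (rule ccontr)
    assume a: "\<not> k \<le> card (Y \<inter> V)"
    have "card (V - Y \<inter> V) = card V - card (Y \<inter> V)"
      using V by (intro card_Diff_subset) auto
    then have "k \<le> card (V - Y \<inter> V)" using a V by linarith
    then obtain X where "X \<subseteq> V - Y \<inter> V" "card X = k" using obtain_subset_with_card_n by metis
    then have "X \<in> F" "Y \<inter> X = {}" by (auto simp: F_def)
    then show False using that by (auto simp: blocking_set_def)
  qed
  have "MIF k F"
  proof (rule MIF_I)
    have "k \<le> card V" using V assms by linarith
    then obtain X where "X \<subseteq> V" "card X = k" using obtain_subset_with_card_n by metis
    then show "F \<noteq> {}" by (auto simp: F_def)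
    show "finite B \<and> card B = k" if "B \<in> F" for B
      using that V by (auto simp: F_def intro: finite_subset)
    show "B \<inter> C \<noteq> {}" if "B \<in> F" "C \<in> F" for B C
    proof
      assume "B \<inter> C = {}"
      moreover have "finite B" "finite C" using that V by (auto simp: F_def intro: finite_subset)
      ultimately have "card (B \<union> C) = k + k" using that by (simp add: F_def card_Un_disjoint)
      moreover have "card (B \<union> C) \<le> card V" using that V by (intro card_mono) (auto simp: F_def)
      ultimately show False using V assms by linarith
    qed
    show "k \<le> card Y" if "finite Y" "blocking_set F Y" for Y
      using big[OF that(2)] card_mono[of Y "Y \<inter> V"] that(1) by auto
    show "Y \<in> F" if "finite Y" "blocking_set F Y" "card Y = k" for Y
    proof -
      have "Y \<inter> V = Y" using big[OF that(2)] that by (intro card_seteq) auto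
      then show ?thesis using that by (auto simp: F_def)
    qed
  qed
  then show ?thesis by blast
qed

lemma MIF_card_points_le_N:
  fixes F :: "'a set set"
  assumes F: "MIF k F"
  shows "finite (points F) \<and> card (points F) \<le> N k"
proof -
  have fin: "finite (points F)" by (rule MIF_points_bound[OF F])
  then obtain f :: "'a \<Rightarrow> nat" where f: "inj_on f (points F)"
    using finite_imp_inj_to_nat_seg by blast
  define G where "G = (`) f ` F"
  have sub: "B \<subseteq> points F" if "B \<in> F" for B using that by (auto simp: points_def)
  define pre where "pre Y = {p \<in> points F. f p \<in> Y}" for Y
  have pre: "finite (pre Y)" "blocking_set F (pre Y)" "card (pre Y) \<le> card Y" "f ` pre Y \<subseteq> Y"
    if "finite Y" "blocking_set G Y" for Y
  proof -
    show "finite (pre Y)" using fin by (simp add: pre_def)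
    show "f ` pre Y \<subseteq> Y" by (auto simp: pre_def)
    have "inj_on f (pre Y)" using f by (rule inj_on_subset) (auto simp: pre_def)
    then show "card (pre Y) \<le> card Y"
      using \<open>f ` pre Y \<subseteq> Y\<close> that(1) by (rule card_inj_on_le)
    show "blocking_set F (pre Y)"
      unfolding blocking_set_def
    proof
      fix B assume "B \<in> F"
      then have "Y \<inter> f ` B \<noteq> {}" using that(2) by (auto simp: G_def blocking_set_def)
      then show "pre Y \<inter> B \<noteq> {}" using sub[OF \<open>B \<in> F\<close>] by (auto simp: pre_def)
    qed
  qed
  have "MIF k G"
  proof (rule MIF_I)
    show "G \<noteq> {}" using MIF_D(1)[OF F] by (simp add: G_def)
    show "finite B \<and> card B = k" if B: "B \<in> G" for B
    proof -
      obtain C where C: "C \<in> F" "B = f ` C" using B by (auto simp: G_def)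
      then show ?thesis
        using MIF_D(2)[OF F C(1)] card_image[OF inj_on_subset[OF f sub[OF C(1)]]] by simp
    qed
    show "B \<inter> C \<noteq> {}" if BG: "B \<in> G" "C \<in> G" for B C
    proof -
      obtain B' C' where BC: "B' \<in> F" "C' \<in> F" "B = f ` B'" "C = f ` C'"
        using BG unfolding G_def by blast
      then obtain x where "x \<in> B'" "x \<in> C'" using MIF_D(3)[OF F BC(1,2)] by blast
      then show ?thesis using BC by blast
    qed
    show "k \<le> card Y" if "finite Y" "blocking_set G Y" for Y
      using pre[OF that] MIF_D(4)[OF F, of "pre Y"] by simp
    show "Y \<in> G" if Y: "finite Y" "blocking_set G Y" "card Y = k" for Y
    proof -
      have "card (pre Y) = k" using pre[OF Y(1,2)] MIF_D(4)[OF F, of "pre Y"] Y by simp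
      moreover from this have "pre Y \<in> F" using pre[OF Y(1,2)] MIF_D(5)[OF F] by blast
      moreover have "card (f ` pre Y) = card (pre Y)"
        by (intro card_image inj_on_subset[OF f] sub) fact
      ultimately have "f ` pre Y = Y" using pre(4)[OF Y(1,2)] Y by (intro card_subset_eq) auto
      then show ?thesis using \<open>pre Y \<in> F\<close> by (auto simp: G_def)
    qed
  qed
  moreover have "points G = f ` points F" by (auto simp: G_def points_def)
  then have "card (points G) = card (points F)" using card_image[OF f] by simp
  ultimately have "card (points F) \<in> {card (points F) | F :: nat set set. MIF k F}"
    by (intro CollectI exI[of _ G]) simp
  then show ?thesis unfolding N_def using fin Max_ge[OF N_set_finite] by blast
qed

lemma set_pair_bound:
  "finite I \<Longrightarrow> (\<And>i. i \<in> I \<Longrightarrow> finite (A i) \<and> card (A i) = k \<and> finite (B i) \<and> card (B i) = t) \<Longrightarrow>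
    (\<And>i j. i \<in> I \<Longrightarrow> j \<in> I \<Longrightarrow> A i \<inter> B j = {} \<longleftrightarrow> i = j) \<Longrightarrow> card I \<le> (t + 1) ^ k"
proof (induction k arbitrary: I A)
  case 0
  then have "A i = {}" if "i \<in> I" for i using that by fastforce
  then have "i = j" if "i \<in> I" "j \<in> I" for i j using 0(3) that by blast
  then show ?case by (simp add: card_le_Suc0_iff_eq[OF 0(1)])
next
  case (Suc k)
  show ?case
  proof (cases "I = {}")
    case False
    then obtain a where a: "a \<in> I" by blast
    define J where "J x = {i \<in> I. x \<in> A i}" for x
    have fB: "finite (B a)" "card (B a) = t" using Suc.prems a by auto
    have J: "card (J x) \<le> (t + 1) ^ k" for x
    proof (rule Suc.IH[where A = "\<lambda>i. A i - {x}"])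
      show "finite (J x)" using Suc.prems(1) by (simp add: J_def)
      show "finite (A i - {x}) \<and> card (A i - {x}) = k \<and> finite (B i) \<and> card (B i) = t"
        if "i \<in> J x" for i
        using that Suc.prems(2)[of i] by (auto simp: J_def)
      show "(A i - {x}) \<inter> B j = {} \<longleftrightarrow> i = j" if "i \<in> J x" "j \<in> J x" for i j
      proof -
        have "x \<notin> B j" using that Suc.prems(3)[of j j] by (auto simp: J_def)
        then have "(A i - {x}) \<inter> B j = A i \<inter> B j" by blast
        then show ?thesis using that Suc.prems(3)[of i j] by (auto simp: J_def)
      qed
    qed
    have "I \<subseteq> insert a (\<Union>x\<in>B a. J x)"
      using Suc.prems(3)[OF _ a] by (fastforce simp: J_def)
    moreover have fU: "finite (\<Union>x\<in>B a. J x)" using fB Suc.prems(1) by (auto simp: J_def)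
    ultimately have "card I \<le> card (insert a (\<Union>x\<in>B a. J x))" by (intro card_mono) auto
    also have "\<dots> \<le> Suc (card (\<Union>x\<in>B a. J x))" using fU by (simp add: card_insert_if)
    also have "card (\<Union>x\<in>B a. J x) \<le> (\<Sum>x\<in>B a. card (J x))" by (rule card_UN_le[OF fB(1)])
    also have "\<dots> \<le> (\<Sum>x\<in>B a. (t + 1) ^ k)" using J by (intro sum_mono) auto
    also have "\<dots> = t * (t + 1) ^ k" using fB by simp
    also have "Suc (t * (t + 1) ^ k) \<le> (t + 1) ^ Suc k" by simp
    finally show ?thesis by simp
  qed simp
qed

lemma ISP_points_bound:
  assumes "ISP k t n A B"
  shows "finite (ISP_points n A B)" "card (ISP_points n A B) \<le> (t + 1) ^ k * (k + t)"
proof -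
  show "finite (ISP_points n A B)" using assms by (auto simp: ISP_def ISP_points_def)
  have n: "card {1..n} \<le> (t + 1) ^ k"
    by (rule set_pair_bound[where A = A and B = B]) (use assms in \<open>auto simp: ISP_def\<close>)
  have "card (ISP_points n A B) \<le> (\<Sum>i\<in>{1..n}. card (A i \<union> B i))"
    unfolding ISP_points_def by (rule card_UN_le) simp
  also have "\<dots> \<le> (\<Sum>i\<in>{1..n}. k + t)"
  proof (rule sum_mono)
    fix i assume "i \<in> {1..n}"
    then show "card (A i \<union> B i) \<le> k + t"
      using assms card_Un_le[of "A i" "B i"] by (auto simp: ISP_def)
  qed
  also have "\<dots> = n * (k + t)" by simp
  also have "\<dots> \<le> (t + 1) ^ k * (k + t)" using n by (intro mult_le_mono1) simp
  finally show "card (ISP_points n A B) \<le> (t + 1) ^ k * (k + t)" .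
qed

lemma nn_set_finite:
  "finite {card (ISP_points n A B) | n (A :: nat \<Rightarrow> nat set) (B :: nat \<Rightarrow> nat set). ISP k t n A B}"
  by (rule finite_subset[of _ "{..(t + 1) ^ k * (k + t)}"]) (auto dest: ISP_points_bound(2))

lemma nn_set_nonempty:
  "{card (ISP_points n A B) | n (A :: nat \<Rightarrow> nat set) (B :: nat \<Rightarrow> nat set). ISP k t n A B} \<noteq> {}"
proof -
  have "ISP k t 1 (\<lambda>_. {..<k}) (\<lambda>_. {k..<k + t})" by (auto simp: ISP_def)
  then show ?thesis by blast
qed

lemma ISP_card_points_le_nn:
  fixes A B :: "nat \<Rightarrow> 'a set"
  assumes "ISP k t n A B"
  shows "finite (ISP_points n A B) \<and> card (ISP_points n A B) \<le> nn k t"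
proof -
  have fin: "finite (ISP_points n A B)" by (rule ISP_points_bound[OF assms])
  then obtain f :: "'a \<Rightarrow> nat" where f: "inj_on f (ISP_points n A B)"
    using finite_imp_inj_to_nat_seg by blast
  have sub: "A i \<subseteq> ISP_points n A B" "B i \<subseteq> ISP_points n A B" if "i \<in> {1..n}" for i
    using that by (auto simp: ISP_points_def)
  have "ISP k t n (\<lambda>i. f ` A i) (\<lambda>i. f ` B i)"
    unfolding ISP_def
  proof (intro conjI ballI)
    fix i assume i: "i \<in> {1..n}"
    show "finite (f ` A i)" "finite (f ` B i)" "card (f ` A i) = k" "card (f ` B i) = t"
      using assms i card_image[OF inj_on_subset[OF f sub(1)[OF i]]]
        card_image[OF inj_on_subset[OF f sub(2)[OF i]]]
      by (auto simp: ISP_def)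
    fix j assume j: "j \<in> {1..n}"
    have "f ` A i \<inter> f ` B j = f ` (A i \<inter> B j)"
      using inj_on_image_Int[OF f sub(1)[OF i] sub(2)[OF j]] by simp
    then show "f ` A i \<inter> f ` B j = {} \<longleftrightarrow> i = j" using assms i j by (auto simp: ISP_def)
  qed
  moreover have "ISP_points n (\<lambda>i. f ` A i) (\<lambda>i. f ` B i) = f ` ISP_points n A B"
    by (auto simp: ISP_points_def)
  then have "card (ISP_points n (\<lambda>i. f ` A i) (\<lambda>i. f ` B i)) = card (ISP_points n A B)"
    using card_image[OF f] by simp
  ultimately have "card (ISP_points n A B) \<in>
      {card (ISP_points n A B) | n (A :: nat \<Rightarrow> nat set) (B :: nat \<Rightarrow> nat set). ISP k t n A B}"
    by (intro CollectI exI[of _ n] exI[of _ "\<lambda>i. f ` A i"] exI[of _ "\<lambda>i. f ` B i"]) simp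
  then show ?thesis unfolding nn_def using fin Max_ge[OF nn_set_finite] by blast
qed

end

theory Submission
  imports Defs
begin

text \<open>
  Let \<open>F\<close> be an MIF(\<open>k\<close>) and let \<open>H \<subseteq> F\<close> be minimal among the subfamilies without a blocking
  set of size at most \<open>k - 2\<close>. By minimality every \<open>A \<in> H\<close> misses some \<open>(k - 2)\<close>-set that meets all
  other blocks of \<open>H\<close>, so \<open>H\<close> is the first half of an ISP(\<open>k\<close>, \<open>k - 2\<close>) and has at most
  \<open>n(k, k - 2)\<close> points. A block of \<open>F\<close> has at most one point outside \<open>H\<close>, since the points inside
  \<open>H\<close> already block \<open>H\<close>. Every point \<open>y\<close> is the only common point of two blocks; for \<open>y\<close>
  outside \<open>H\<close>, deleting \<open>y\<close> from them leaves disjoint \<open>(k - 1)\<close>-sets \<open>P\<^sub>y\<close> and \<open>Q\<^sub>y\<close>, and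
  sets belonging to different \<open>y\<close> still meet. Bollobas' inequality applied to all pairs
  \<open>(P\<^sub>y, Q\<^sub>y)\<close> and \<open>(Q\<^sub>y, P\<^sub>y)\<close> shows that twice the number of such \<open>y\<close> is at most
  \<open>(2k - 2 choose k - 1)\<close>.
\<close>

section \<open>Set pair inequalities\<close>

text \<open>The absorption identity for binomials, in the form that the averaging argument needs:
  deleting each of the \<open>b\<close> points of a second set in turn gives \<open>b\<close> equal
  weights, and this is their total.\<close>

lemma real_mult_inverse_choose:
  assumes "b > 0"
  shows "real b / real ((a + (b - 1)) choose a) = real (a + b) / real ((a + b) choose a)"
proof -
  obtain c where c: "b = Suc c" using assms gr0_implies_Suc by blast
  have "Suc c * (Suc (a + c) choose Suc c) = Suc (a + c) * ((a + c) choose c)"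
    by (rule Suc_times_binomial)
  moreover have "Suc (a + c) choose Suc c = Suc (a + c) choose a"
    using binomial_symmetric[of a "Suc (a + c)"] by simp
  moreover have "(a + c) choose c = (a + c) choose a"
    using binomial_symmetric[of a "a + c"] by simp
  ultimately have "Suc c * (Suc (a + c) choose a) = Suc (a + c) * ((a + c) choose a)"
    by simp
  then have "real (Suc c) * real (Suc (a + c) choose a) = real (Suc (a + c)) * real ((a + c) choose a)"
    by (metis of_nat_mult)
  moreover have "real (Suc (a + c) choose a) > 0" "real ((a + c) choose a) > 0"
    by simp_all
  ultimately show ?thesis
    unfolding c by (simp add: field_simps)
qed

text \<open>
  Induction on the ground set \<open>X\<close>: for each \<open>x \<in> X\<close> the pairs with \<open>x \<notin> A i\<close>, with \<open>x\<close> deleted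
  from \<open>B i\<close>, again form a set pair system; averaging over \<open>x\<close> reproduces each term exactly.
\<close>

theorem Bollobas_inequality:
  assumes "finite X" "finite I"
    and "\<And>i. i \<in> I \<Longrightarrow> A i \<subseteq> X \<and> B i \<subseteq> X"
    and "\<And>i j. i \<in> I \<Longrightarrow> j \<in> I \<Longrightarrow> A i \<inter> B j = {} \<longleftrightarrow> i = j"
  shows "(\<Sum>i\<in>I. 1 / real ((card (A i) + card (B i)) choose card (A i))) \<le> 1"
  using assms
proof (induction "card X" arbitrary: X I B rule: less_induct)
  case less
  note finX = less.prems(1) and finI = less.prems(2) and sub = less.prems(3)
    and cross = less.prems(4)
  define w where "w a b = 1 / real ((a + b) choose a)" for a b :: nat
  show ?case
  proof (cases "\<exists>i\<in>I. B i = {}")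
    case True
    then obtain i where i: "i \<in> I" "B i = {}" by blast
    \<comment> \<open>An empty \<open>B i\<close> is disjoint from every first set, so
      \<open>i\<close> is the only index, and its weight is 1.\<close>
    then have "I = {i}" using cross by blast
    then show ?thesis using i by simp
  next
    case False
    have finA: "finite (A i)" and finB: "finite (B i)" if "i \<in> I" for i
      using sub[OF that] finX finite_subset by blast+
    have dis: "A i \<inter> B i = {}" if "i \<in> I" for i
      using cross that by blast
    show ?thesis
    proof (cases "X = {}")
      case True
      then have "I = {}" using False sub by blast
      then show ?thesis by simp
    next
      case nonempty: False
      have step: "(\<Sum>i\<in>{i\<in>I. x \<notin> A i}. w (card (A i)) (card (B i - {x}))) \<le> 1" if x: "x \<in> X" for x
        unfolding w_def
      proof (rule less.hyps[of "X - {x}"])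
        show "card (X - {x}) < card X" using finX x by (rule card_Diff1_less)
        show "finite (X - {x})" using finX by simp
        show "finite {i\<in>I. x \<notin> A i}" using finI by simp
        show "A i \<subseteq> X - {x} \<and> B i - {x} \<subseteq> X - {x}" if "i \<in> {i\<in>I. x \<notin> A i}" for i
          using that sub by blast
        show "A i \<inter> (B j - {x}) = {} \<longleftrightarrow> i = j"
          if "i \<in> {i\<in>I. x \<notin> A i}" "j \<in> {i\<in>I. x \<notin> A i}" for i j
        proof -
          have "A i \<inter> (B j - {x}) = A i \<inter> B j" using that by blast
          then show ?thesis using that cross by simp
        qed
      qed
      \<comment> \<open>With a, b the sizes of \<open>A i\<close>, \<open>B i\<close>: points of
        \<open>A i\<close> contribute nothing, those of \<open>B i\<close> together a + b times the
        weight of pair \<open>i\<close>, and each remaining point that weight once. The coefficients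
        add up to \<open>card X\<close>.\<close>
      have term_sum: "(\<Sum>x\<in>X. if x \<notin> A i then w (card (A i)) (card (B i - {x})) else 0)
          = real (card X) * w (card (A i)) (card (B i))" (is "?S = _") if i: "i \<in> I" for i
      proof -
        let ?a = "card (A i)" and ?b = "card (B i)"
        have b: "?b > 0" using False i finB[OF i] by (simp add: card_gt_0_iff)
        have X: "X = A i \<union> (B i \<union> (X - A i - B i))" using sub[OF i] by blast
        have "card (X - A i - B i) = card (X - (A i \<union> B i))"
          by (rule arg_cong[of _ _ card]) blast
        also have "\<dots> = card X - card (A i \<union> B i)"
          using sub[OF i] finA[OF i] finB[OF i] by (intro card_Diff_subset) auto
        also have "\<dots> = card X - (?a + ?b)"
          using dis[OF i] finA[OF i] finB[OF i] by (simp add: card_Un_disjoint)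
        finally have rest: "card (X - A i - B i) = card X - (?a + ?b)" .
        have le: "?a + ?b \<le> card X"
        proof -
          have "?a + ?b = card (A i \<union> B i)"
            using dis[OF i] finA[OF i] finB[OF i] by (simp add: card_Un_disjoint)
          also have "\<dots> \<le> card X" using sub[OF i] finX by (intro card_mono) auto
          finally show ?thesis .
        qed
        let ?g = "\<lambda>x. if x \<notin> A i then w ?a (card (B i - {x})) else 0"
        have "?S = sum ?g (A i \<union> (B i \<union> (X - A i - B i)))"
          by (rule arg_cong[OF X])
        also have "\<dots> = sum ?g (A i) + sum ?g (B i \<union> (X - A i - B i))"
          using dis[OF i] finA[OF i] finB[OF i] finX by (intro sum.union_disjoint) auto
        also have "sum ?g (B i \<union> (X - A i - B i)) = sum ?g (B i) + sum ?g (X - A i - B i)"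
          using finB[OF i] finX by (intro sum.union_disjoint) auto
        also have "sum ?g (A i) = 0" by simp
        also have "sum ?g (B i) = (\<Sum>x\<in>B i. w ?a (?b - 1))"
          using dis[OF i] by (intro sum.cong) auto
        also have "\<dots> = real (?a + ?b) * w ?a ?b"
          using real_mult_inverse_choose[OF b, of ?a] by (simp add: w_def)
        also have "sum ?g (X - A i - B i) = (\<Sum>x\<in>X - A i - B i. w ?a ?b)"
          by (intro sum.cong) auto
        also have "\<dots> = (real (card X) - real (?a + ?b)) * w ?a ?b"
          using rest le by simp
        finally show ?thesis by (simp add: algebra_simps)
      qed
      have "real (card X) * (\<Sum>i\<in>I. w (card (A i)) (card (B i)))
          = (\<Sum>i\<in>I. \<Sum>x\<in>X. if x \<notin> A i then w (card (A i)) (card (B i - {x})) else 0)"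
        by (simp add: sum_distrib_left term_sum)
      also have "\<dots> = (\<Sum>x\<in>X. \<Sum>i\<in>I. if x \<notin> A i then w (card (A i)) (card (B i - {x})) else 0)"
        by (rule sum.swap)
      also have "\<dots> = (\<Sum>x\<in>X. \<Sum>i\<in>{i\<in>I. x \<notin> A i}. w (card (A i)) (card (B i - {x})))"
        using finI by (intro sum.cong refl sum.inter_filter[symmetric])
      also have "\<dots> \<le> (\<Sum>x\<in>X. 1)" by (intro sum_mono step)
      finally have "real (card X) * (\<Sum>i\<in>I. w (card (A i)) (card (B i))) \<le> real (card X) * 1"
        by simp
      moreover have "real (card X) > 0" using nonempty finX by (simp add: card_gt_0_iff)
      ultimately have "(\<Sum>i\<in>I. w (card (A i)) (card (B i))) \<le> 1"
        using mult_le_cancel_left_pos by blast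
      then show ?thesis by (simp add: w_def)
    qed
  qed
qed

corollary uniform_set_pair_card_le:
  assumes "finite I"
    and size: "\<And>i. i \<in> I \<Longrightarrow> finite (A i) \<and> card (A i) = a \<and> finite (B i) \<and> card (B i) = b"
    and "\<And>i j. i \<in> I \<Longrightarrow> j \<in> I \<Longrightarrow> A i \<inter> B j = {} \<longleftrightarrow> i = j"
  shows "card I \<le> (a + b) choose a"
proof -
  have "(\<Sum>i\<in>I. 1 / real ((card (A i) + card (B i)) choose card (A i))) \<le> 1"
    by (rule Bollobas_inequality[of "\<Union>i\<in>I. A i \<union> B i"]) (use assms in auto)
  then have "real (card I) / real ((a + b) choose a) \<le> 1"
    using size by simp
  then show ?thesis by (simp add: divide_le_eq)
qed

lemma symmetric_set_pair_card_le:
  assumes "finite Y" "a > 0"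
    and size: "\<And>y. y \<in> Y \<Longrightarrow> finite (P y) \<and> card (P y) = a \<and> finite (Q y) \<and> card (Q y) = a"
    and disj: "\<And>y. y \<in> Y \<Longrightarrow> P y \<inter> Q y = {}"
    and meet: "\<And>y z. y \<in> Y \<Longrightarrow> z \<in> Y \<Longrightarrow> y \<noteq> z \<Longrightarrow>
      P y \<inter> P z \<noteq> {} \<and> P y \<inter> Q z \<noteq> {} \<and> Q y \<inter> Q z \<noteq> {}"
  shows "2 * card Y \<le> (2 * a) choose a"
proof -
  \<comment> \<open>The Boolean records the orientation of a pair; using both orientations is the
    source of the factor 2.\<close>
  define A where "A i = (if snd i then P (fst i) else Q (fst i))" for i
  define B where "B i = (if snd i then Q (fst i) else P (fst i))" for i
  have "card (Y \<times> (UNIV :: bool set)) \<le> (a + a) choose a"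
  proof (rule uniform_set_pair_card_le)
    show "finite (Y \<times> (UNIV :: bool set))" using assms(1) by simp
    show "finite (A i) \<and> card (A i) = a \<and> finite (B i) \<and> card (B i) = a"
      if "i \<in> Y \<times> UNIV" for i
      using that size by (auto simp: A_def B_def)
    show "A i \<inter> B j = {} \<longleftrightarrow> i = j" if ij: "i \<in> Y \<times> UNIV" "j \<in> Y \<times> UNIV" for i j
    proof -
      obtain y s z t where i: "i = (y, s)" and j: "j = (z, t)" and yz: "y \<in> Y" "z \<in> Y"
        using ij by auto
      \<comment> \<open>For one \<open>y\<close> in opposite orientations, \<open>A i\<close> and
        \<open>B j\<close> are the same set; they meet because \<open>a > 0\<close> makes it
        nonempty.\<close>
      have "P y \<noteq> {}" "Q y \<noteq> {}" using size[OF yz(1)] assms(2) by auto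
      then show ?thesis
        using disj[OF yz(1)] meet[OF yz] meet[OF yz(2,1)] i j
        by (cases "y = z"; cases s; cases t) (auto simp: A_def B_def Int_commute)
    qed
  qed
  then show ?thesis using assms(1) by (simp add: card_cartesian_product mult_2 mult_2_right)
qed

section \<open>Critical subfamilies\<close>

text \<open>As \<open>F\<close> is finite, some subfamily without a small blocking set is minimal
  under inclusion; dropping any member of it must then create such a blocking set.\<close>

lemma blocking_set_critical_subfamily:
  assumes "finite F" "\<not> (\<exists>T. finite T \<and> card T \<le> t \<and> blocking_set F T)"
  obtains H where "H \<subseteq> F" "\<not> (\<exists>T. finite T \<and> card T \<le> t \<and> blocking_set H T)"
    and "\<And>A. A \<in> H \<Longrightarrow> \<exists>T. finite T \<and> card T \<le> t \<and> blocking_set (H - {A}) T"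
proof -
  define S where "S = {H. H \<subseteq> F \<and> \<not> (\<exists>T. finite T \<and> card T \<le> t \<and> blocking_set H T)}"
  have "S \<subseteq> Pow F" by (auto simp: S_def)
  then have "finite S" using assms(1) by (simp add: finite_subset)
  moreover have "F \<in> S" using assms(2) by (simp add: S_def)
  ultimately obtain H where H: "H \<in> S" and min: "\<And>G. G \<in> S \<Longrightarrow> G \<subseteq> H \<Longrightarrow> H = G"
    using finite_has_minimal[of S] by auto
  show ?thesis
  proof
    show "H \<subseteq> F" "\<not> (\<exists>T. finite T \<and> card T \<le> t \<and> blocking_set H T)" using H unfolding S_def by blast+
    show "\<exists>T. finite T \<and> card T \<le> t \<and> blocking_set (H - {A}) T" if "A \<in> H" for A
    proof (rule ccontr)
      assume "\<not> ?thesis"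
      then have "H - {A} \<in> S" using H unfolding S_def by blast
      then have "H = H - {A}" using min by blast
      then show False using that by blast
    qed
  qed
qed

text \<open>Pair each \<open>A\<close> with a small set \<open>T A\<close> blocking the rest of
  \<open>H\<close>. If \<open>T A\<close> met \<open>A\<close> it would block all of
  \<open>H\<close>, so the pairs have exactly the intersections that an ISP demands.\<close>

lemma critical_family_points_le_nn:
  fixes H :: "'a set set"
  assumes "finite H" "k > 0"
    and size: "\<And>A. A \<in> H \<Longrightarrow> finite A \<and> card A = k"
    and no: "\<not> (\<exists>T. finite T \<and> card T \<le> t \<and> blocking_set H T)"
    and crit: "\<And>A. A \<in> H \<Longrightarrow> \<exists>T. finite T \<and> card T \<le> t \<and> blocking_set (H - {A}) T"
  shows "finite (points H)" "card (points H) \<le> nn k t"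
proof -
  obtain T where T: "\<And>A. A \<in> H \<Longrightarrow> finite (T A) \<and> card (T A) \<le> t \<and> blocking_set (H - {A}) (T A)"
    using crit by metis
  have disj: "A \<inter> T A = {}" if A: "A \<in> H" for A
  proof (rule ccontr)
    assume "A \<inter> T A \<noteq> {}"
    then have "blocking_set H (T A)" using T[OF A] by (auto simp: blocking_set_def)
    then show False using T[OF A] no by blast
  qed
  have cardT: "card (T A) = t" if A: "A \<in> H" for A
  proof -
    \<comment> \<open>One point of \<open>A\<close> added to \<open>T A\<close> blocks
      \<open>H\<close>, hence gives more than \<open>t\<close> points; so \<open>T A\<close> cannot
      have fewer than \<open>t\<close>.\<close>
    obtain a where a: "a \<in> A" using size[OF A] assms(2) by fastforce
    then have "blocking_set H (insert a (T A))" using T[OF A] by (auto simp: blocking_set_def)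
    then have "card (insert a (T A)) > t" using T[OF A] no by (meson finite_insert not_le)
    then show ?thesis using T[OF A] by (simp add: card_insert_if split: if_splits)
  qed
  obtain h where h: "bij_betw h {1..card H} H"
    using ex_bij_betw_nat_finite_1[OF assms(1)] by blast
  have hH: "h i \<in> H" if "i \<in> {1..card H}" for i using h that by (auto simp: bij_betw_def)
  have "ISP k t (card H) h (T \<circ> h)"
    unfolding ISP_def
  proof (intro conjI ballI)
    fix i assume i: "i \<in> {1..card H}"
    show "finite (h i)" "finite ((T \<circ> h) i)" "card (h i) = k" "card ((T \<circ> h) i) = t"
      using size[OF hH[OF i]] T[OF hH[OF i]] cardT[OF hH[OF i]] by auto
    fix j assume j: "j \<in> {1..card H}"
    show "h i \<inter> (T \<circ> h) j = {} \<longleftrightarrow> i = j"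
    proof
      assume "i = j"
      then show "h i \<inter> (T \<circ> h) j = {}" using disj[OF hH[OF i]] by simp
    next
      assume "h i \<inter> (T \<circ> h) j = {}"
      moreover have "blocking_set (H - {h j}) (T (h j))" using T[OF hH[OF j]] by blast
      ultimately have "h i = h j" using hH[OF i] unfolding blocking_set_def o_def by blast
      then show "i = j" using h i j unfolding bij_betw_def by (meson inj_onD)
    qed
  qed
  then have le: "finite (ISP_points (card H) h (T \<circ> h))"
      "card (ISP_points (card H) h (T \<circ> h)) \<le> nn k t"
    using ISP_card_points_le_nn by blast+
  have "points H = (\<Union>i\<in>{1..card H}. h i)"
    using h unfolding bij_betw_def points_def by metis
  then have sub: "points H \<subseteq> ISP_points (card H) h (T \<circ> h)"
    by (auto simp: ISP_points_def)
  show "finite (points H)" using sub le(1) by (rule finite_subset)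
  show "card (points H) \<le> nn k t" using card_mono[OF le(1) sub] le(2) by linarith
qed

section \<open>Counting the points of an MIF\<close>

text \<open>A block through \<open>y\<close> without \<open>y\<close> is too small to block
  \<open>F\<close>. A block that it misses still meets the full block, necessarily in
  \<open>y\<close> alone.\<close>

lemma MIF_point_is_block_intersection:
  assumes F: "MIF k F" and y: "y \<in> points F"
  obtains B C where "B \<in> F" "C \<in> F" "B \<inter> C = {y}"
proof -
  obtain B where B: "B \<in> F" "y \<in> B" using y by (auto simp: points_def)
  have "card (B - {y}) < k" using B MIF_D(2)[OF F B(1)] by (metis card_Diff1_less)
  then have "\<not> blocking_set F (B - {y})" using MIF_D(4)[OF F, of "B - {y}"] MIF_D(2)[OF F B(1)] by auto
  then obtain C where C: "C \<in> F" "(B - {y}) \<inter> C = {}" by (auto simp: blocking_set_def)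
  then have "B \<inter> C = {y}" using MIF_D(3)[OF F B(1) C(1)] by blast
  then show ?thesis using that B C by blast
qed

lemma MIF_card_points_le:
  assumes F: "MIF k F" and k: "k \<ge> 2"
  shows "2 * card (points F) \<le> ((2 * k - 2) choose (k - 1)) + 2 * nn k (k - 2)"
proof -
  have finF: "finite F" using MIF_superset_bound[OF F, of "{}" k] by auto
  have "\<not> (\<exists>T. finite T \<and> card T \<le> k - 2 \<and> blocking_set F T)"
    using MIF_D(4)[OF F] k by fastforce
  then obtain H where H: "H \<subseteq> F" "\<not> (\<exists>T. finite T \<and> card T \<le> k - 2 \<and> blocking_set H T)"
    and crit: "\<And>A. A \<in> H \<Longrightarrow> \<exists>T. finite T \<and> card T \<le> k - 2 \<and> blocking_set (H - {A}) T"
    using blocking_set_critical_subfamily[OF finF] by metis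
  have finH: "finite H" using H(1) finF by (rule finite_subset)
  have "k > 0" using k by simp
  have sizeH: "finite A \<and> card A = k" if "A \<in> H" for A
    using that MIF_D(2)[OF F] H(1) by blast
  note ptsH = critical_family_points_le_nn[OF finH \<open>k > 0\<close> sizeH H(2) crit]
  define Y where "Y = points F - points H"
  have finY: "finite Y" using MIF_points_bound(1)[OF F] by (simp add: Y_def)
  have one: "y = z" if B: "B \<in> F" "y \<in> B" "z \<in> B" "y \<in> Y" "z \<in> Y" for B y z
  proof (rule ccontr)
    assume ne: "y \<noteq> z"
    have fB: "finite B" "card B = k" using MIF_D(2)[OF F B(1)] by auto
    \<comment> \<open>No block of \<open>H\<close> contains \<open>y\<close> or \<open>z\<close>, so
      deleting both leaves a blocking set of \<open>H\<close> with \<open>k - 2\<close> points, just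
      small enough to be excluded by the choice of \<open>H\<close>.\<close>
    have "blocking_set H (B - {y, z})"
      unfolding blocking_set_def
    proof
      fix A assume A: "A \<in> H"
      then have "B \<inter> A \<noteq> {}" using MIF_D(3)[OF F B(1)] H(1) by blast
      moreover have "y \<notin> A" "z \<notin> A" using A B by (auto simp: Y_def points_def)
      ultimately show "(B - {y, z}) \<inter> A \<noteq> {}" by blast
    qed
    moreover have "card (B - {y, z}) = k - 2"
      using B fB ne by (subst card_Diff_subset) auto
    ultimately show False using H(2) fB(1) by (metis finite_Diff order_refl)
  qed
  have "\<forall>y\<in>Y. \<exists>B C. B \<in> F \<and> C \<in> F \<and> B \<inter> C = {y}"
    using MIF_point_is_block_intersection[OF F] unfolding Y_def by (metis DiffD1)
  then obtain B C where BC: "\<And>y. y \<in> Y \<Longrightarrow> B y \<in> F \<and> C y \<in> F \<and> B y \<inter> C y = {y}"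
    by metis
  have meet: "(D - {y}) \<inter> (E - {z}) \<noteq> {}"
    if "D \<in> F" "E \<in> F" "y \<in> D" "z \<in> E" "y \<in> Y" "z \<in> Y" "y \<noteq> z" for D E y z
  proof -
    \<comment> \<open>By \<open>one\<close>, \<open>y\<close> is the only point of \<open>Y\<close>
      in \<open>D\<close>, and \<open>z\<close> the only one in \<open>E\<close>. So a common point
      of \<open>D\<close> and \<open>E\<close> is neither and survives both deletions.\<close>
    have "z \<notin> D" "y \<notin> E" using one that by blast+
    then show ?thesis using MIF_D(3)[OF F that(1,2)] by blast
  qed
  have "2 * card Y \<le> (2 * (k - 1)) choose (k - 1)"
  proof (rule symmetric_set_pair_card_le[where P = "\<lambda>y. B y - {y}" and Q = "\<lambda>y. C y - {y}"])
    show "finite Y" by (fact finY)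
    show "k - 1 > 0" using k by simp
    show "finite (B y - {y}) \<and> card (B y - {y}) = k - 1 \<and>
        finite (C y - {y}) \<and> card (C y - {y}) = k - 1" if y: "y \<in> Y" for y
      using BC[OF y] MIF_D(2)[OF F, of "B y"] MIF_D(2)[OF F, of "C y"]
      by (auto simp: card_Diff_singleton_if)
    show "(B y - {y}) \<inter> (C y - {y}) = {}" if "y \<in> Y" for y
      using BC[OF that] by blast
    fix y z assume yz: "y \<in> Y" "z \<in> Y" "y \<noteq> z"
    have in_blocks: "x \<in> B x" "x \<in> C x" if "x \<in> Y" for x using BC[OF that] by blast+
    show "(B y - {y}) \<inter> (B z - {z}) \<noteq> {} \<and> (B y - {y}) \<inter> (C z - {z}) \<noteq> {} \<and>
        (C y - {y}) \<inter> (C z - {z}) \<noteq> {}"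
      using BC[OF yz(1)] BC[OF yz(2)] in_blocks yz by (intro conjI meet) auto
  qed
  moreover have "card (points F) \<le> card (points H) + card Y"
  proof -
    have "card (points F) \<le> card (points H \<union> Y)"
      using ptsH(1) finY by (intro card_mono) (auto simp: Y_def)
    also have "\<dots> \<le> card (points H) + card Y" by (rule card_Un_le)
    finally show ?thesis .
  qed
  moreover have "2 * (k - 1) = 2 * k - 2" by simp
  ultimately show ?thesis using ptsH(2) by simp
qed

theorem theorem2p7:
  fixes k :: nat
  assumes "k \<ge> 2"
  shows "real (N k) \<le> 1 / 2 * real ((2 * k - 2) choose (k - 1)) + real (nn k (k - 2))"
proof -
  have "N k \<in> {card (points F) | F :: nat set set. MIF k F}"
    unfolding N_def using assms by (intro Max_in N_set_finite N_set_nonempty) simp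
  then obtain F :: "nat set set" where "MIF k F" "N k = card (points F)" by blast
  \<comment> \<open>The doubled form keeps the estimate in the natural numbers; halving is left to
    the reals.\<close>
  then have "2 * N k \<le> ((2 * k - 2) choose (k - 1)) + 2 * nn k (k - 2)"
    using MIF_card_points_le assms by metis
  then have "real (2 * N k) \<le> real (((2 * k - 2) choose (k - 1)) + 2 * nn k (k - 2))"
    by (rule of_nat_mono)
  then show ?thesis by simp
qed

end
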